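(* Let $\mathcal E_1=(Z_1,\sigma_1,\kappa_1)$ and $\mathcal E_2=(Z_2,\sigma_2,\kappa_2)$ be weighted dual skeletons and let $\phi:\mathcal E_1\to\mathcal E_2$ be a surjective morphism. Then $$\phi_\#(\Sigma_1)\subseteq\Sigma_2,$$ where $\Sigma_i$ is the set of neutral distributions of $\mathcal E_i$ in the open simplex; that is, the pushforward of a neutral distribution is neutral.
   Context: A weighted dual skeleton is a triple $(Z,\sigma,\kappa)$ where $Z$ is a non-empty finite set, $\sigma:Z\to Z$ satisfies $\sigma^2=\mathrm{id}$, and $\kappa:Z\to\mathbb R_{>0}$ satisfies $\kappa(z)\kappa(\sigma(z))=K$ for all $z\in Z$, with $K>0$ constant. A morphism $\phi:(Z_1,\sigma_1,\kappa_1)\to(Z_2,\sigma_2,\kappa_2)$ is a map $\phi:Z_1\to Z_2$ with $\phi(\sigma_1(z))=\sigma_2(\phi(z))$ and $\kappa_1(z)=\kappa_2(\phi(z))$ for all $z\in Z_1$; it is surjective if it is surjective as a map of sets. The orbit ratio at $z$ is $r_z=(\kappa(\sigma(z))/\kappa(z))^{1/2}$. A probability vector $\pi$ on $Z$ in the open simplex (all $\pi_z>0$) is neutral if $\pi_z/\pi_{\sigma(z)}=r_z$ for every $z\in Z$. The pushforward of a probability vector $\pi$ on $Z_1$ is the probability vector on $Z_2$ given by $(\phi_\#\pi)_{z'}=\sum_{z:\,\phi(z)=z'}\pi_z$. *)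

theory Defs
  imports Complex_Main "HOL-Library.FuncSet"
begin

text \<open>Skeletons are given on a carrier set; the values of the maps outside the carrier are irrelevant.
  The constant \<open>K\<close> is not part of the triple.\<close>

definition weighted_dual_skeleton :: "'a set \<Rightarrow> ('a \<Rightarrow> 'a) \<Rightarrow> ('a \<Rightarrow> real) \<Rightarrow> bool" where
  "weighted_dual_skeleton Z \<sigma> \<kappa> \<longleftrightarrow>
     finite Z \<and> Z \<noteq> {} \<and> \<sigma> \<in> Z \<rightarrow> Z \<and> (\<forall>z\<in>Z. \<sigma> (\<sigma> z) = z) \<and>
     (\<forall>z\<in>Z. \<kappa> z > 0) \<and> (\<exists>K>0. \<forall>z\<in>Z. \<kappa> z * \<kappa> (\<sigma> z) = K)"

definition skeleton_morphism ::
  "'a set \<Rightarrow> ('a \<Rightarrow> 'a) \<Rightarrow> ('a \<Rightarrow> real) \<Rightarrow> 'b set \<Rightarrow> ('b \<Rightarrow> 'b) \<Rightarrow> ('b \<Rightarrow> real) \<Rightarrow> ('a \<Rightarrow> 'b) \<Rightarrow> bool" where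
  "skeleton_morphism Z1 \<sigma>1 \<kappa>1 Z2 \<sigma>2 \<kappa>2 \<phi> \<longleftrightarrow>
     \<phi> \<in> Z1 \<rightarrow> Z2 \<and> (\<forall>z\<in>Z1. \<phi> (\<sigma>1 z) = \<sigma>2 (\<phi> z)) \<and> (\<forall>z\<in>Z1. \<kappa>1 z = \<kappa>2 (\<phi> z))"

definition orbit_ratio :: "('a \<Rightarrow> 'a) \<Rightarrow> ('a \<Rightarrow> real) \<Rightarrow> 'a \<Rightarrow> real" where
  "orbit_ratio \<sigma> \<kappa> z = sqrt (\<kappa> (\<sigma> z) / \<kappa> z)"

text \<open>Vectors indexed by \<open>Z\<close> are total functions vanishing outside \<open>Z\<close>, so that each vector has
  exactly one representation.\<close>

definition open_simplex :: "'a set \<Rightarrow> ('a \<Rightarrow> real) set" where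
  "open_simplex Z = {\<pi>. (\<forall>z\<in>Z. \<pi> z > 0) \<and> (\<forall>z. z \<notin> Z \<longrightarrow> \<pi> z = 0) \<and> (\<Sum>z\<in>Z. \<pi> z) = 1}"

definition neutral_distributions :: "'a set \<Rightarrow> ('a \<Rightarrow> 'a) \<Rightarrow> ('a \<Rightarrow> real) \<Rightarrow> ('a \<Rightarrow> real) set" where
  "neutral_distributions Z \<sigma> \<kappa> =
     {\<pi> \<in> open_simplex Z. \<forall>z\<in>Z. \<pi> z / \<pi> (\<sigma> z) = orbit_ratio \<sigma> \<kappa> z}"

definition pushforward :: "'a set \<Rightarrow> ('a \<Rightarrow> 'b) \<Rightarrow> ('a \<Rightarrow> real) \<Rightarrow> ('b \<Rightarrow> real)" where
  "pushforward Z \<phi> \<pi> z' = (\<Sum>z | z \<in> Z \<and> \<phi> z = z'. \<pi> z)"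

end

theory Submission
  imports Defs
begin

text \<open>
  Since a morphism preserves weights and commutes with the involutions, the orbit ratio of a point
  depends only on its image. Neutrality of \<open>\<pi>\<close>, written without division as
  \<open>\<pi> z = r\<^sub>z * \<pi> (\<sigma>1 z)\<close>, therefore has a constant factor along each fibre of \<open>\<phi>\<close>, and summing over
  the fibre above \<open>z'\<close> pulls that factor out. The remaining sum of \<open>\<pi> (\<sigma>1 z)\<close> is the mass of the
  fibre above \<open>\<sigma>2 z'\<close>, because \<open>\<sigma>1\<close> maps one fibre bijectively onto the other
  (\<open>pushforward_comp_involution\<close>). So the pushforward satisfies the same balance relation.
  Surjectivity of \<open>\<phi>\<close> makes every fibre non-empty, which keeps the pushforward strictly positive
  (\<open>pushforward_in_open_simplex\<close>).
\<close>

lemma pushforward_in_open_simplex: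
  assumes fin: "finite Z" and \<pi>: "\<pi> \<in> open_simplex Z"
  shows "pushforward Z \<phi> \<pi> \<in> open_simplex (\<phi> ` Z)"
proof -
  have pos: "\<pi> z > 0" if "z \<in> Z" for z
    using \<pi> that by (simp add: open_simplex_def)
  have "pushforward Z \<phi> \<pi> z' > 0" if "z' \<in> \<phi> ` Z" for z'
    unfolding pushforward_def using fin that by (intro sum_pos) (auto simp: pos)
  moreover have "pushforward Z \<phi> \<pi> z' = 0" if "z' \<notin> \<phi> ` Z" for z'
    unfolding pushforward_def using that by (intro sum.neutral) auto
  moreover have "(\<Sum>z'\<in>\<phi> ` Z. pushforward Z \<phi> \<pi> z') = 1"
    unfolding pushforward_def using \<pi> sum.image_gen[OF fin, of \<pi> \<phi>]
    by (simp add: open_simplex_def)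
  ultimately show ?thesis
    by (simp add: open_simplex_def)
qed

lemma orbit_ratio_morphism:
  assumes "skeleton_morphism Z1 \<sigma>1 \<kappa>1 Z2 \<sigma>2 \<kappa>2 \<phi>" and "\<sigma>1 \<in> Z1 \<rightarrow> Z1" and "z \<in> Z1"
  shows "orbit_ratio \<sigma>1 \<kappa>1 z = orbit_ratio \<sigma>2 \<kappa>2 (\<phi> z)"
  using assms by (auto simp: skeleton_morphism_def orbit_ratio_def Pi_iff)

text \<open>An equivariant map sends the \<open>\<sigma>1\<close>-image of the fibre above \<open>z'\<close> into the fibre above \<open>\<sigma>2 z'\<close>.
  As both maps are involutions, the same argument at \<open>\<sigma>2 z'\<close> provides the inverse, so the two fibre
  sums are reindexings of each other.\<close>

lemma pushforward_comp_involution: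
  assumes \<sigma>1: "\<sigma>1 \<in> Z1 \<rightarrow> Z1" "\<And>z. z \<in> Z1 \<Longrightarrow> \<sigma>1 (\<sigma>1 z) = z"
    and equivariant: "\<And>z. z \<in> Z1 \<Longrightarrow> \<phi> (\<sigma>1 z) = \<sigma>2 (\<phi> z)"
    and z': "\<sigma>2 (\<sigma>2 z') = z'"
  shows "pushforward Z1 \<phi> (\<lambda>z. \<pi> (\<sigma>1 z)) z' = pushforward Z1 \<phi> \<pi> (\<sigma>2 z')"
  unfolding pushforward_def
  by (rule sum.reindex_bij_witness[where i = \<sigma>1 and j = \<sigma>1])
    (use assms in \<open>auto simp: Pi_iff\<close>)

theorem proposition9p1:
  fixes Z1 :: "'a set" and \<sigma>1 :: "'a \<Rightarrow> 'a" and \<kappa>1 :: "'a \<Rightarrow> real"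
    and Z2 :: "'b set" and \<sigma>2 :: "'b \<Rightarrow> 'b" and \<kappa>2 :: "'b \<Rightarrow> real"
    and \<phi> :: "'a \<Rightarrow> 'b"
  assumes "weighted_dual_skeleton Z1 \<sigma>1 \<kappa>1"
    and "weighted_dual_skeleton Z2 \<sigma>2 \<kappa>2"
    and "skeleton_morphism Z1 \<sigma>1 \<kappa>1 Z2 \<sigma>2 \<kappa>2 \<phi>"
    and "\<phi> ` Z1 = Z2"
  shows "pushforward Z1 \<phi> ` neutral_distributions Z1 \<sigma>1 \<kappa>1 \<subseteq> neutral_distributions Z2 \<sigma>2 \<kappa>2"
proof (rule image_subsetI)
  fix \<pi> assume \<pi>: "\<pi> \<in> neutral_distributions Z1 \<sigma>1 \<kappa>1"
  have fin: "finite Z1" and \<sigma>1: "\<sigma>1 \<in> Z1 \<rightarrow> Z1" "\<And>z. z \<in> Z1 \<Longrightarrow> \<sigma>1 (\<sigma>1 z) = z"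
    using assms(1) by (auto simp: weighted_dual_skeleton_def)
  have \<sigma>2: "\<sigma>2 \<in> Z2 \<rightarrow> Z2" "\<And>z'. z' \<in> Z2 \<Longrightarrow> \<sigma>2 (\<sigma>2 z') = z'"
    using assms(2) by (auto simp: weighted_dual_skeleton_def)
  have equivariant: "\<And>z. z \<in> Z1 \<Longrightarrow> \<phi> (\<sigma>1 z) = \<sigma>2 (\<phi> z)"
    using assms(3) by (simp add: skeleton_morphism_def)
  have \<pi>_simplex: "\<pi> \<in> open_simplex Z1"
    using \<pi> by (simp add: neutral_distributions_def)
  let ?\<rho> = "pushforward Z1 \<phi> \<pi>"
  have simplex: "?\<rho> \<in> open_simplex Z2"
    using pushforward_in_open_simplex[OF fin \<pi>_simplex, of \<phi>] assms(4) by simp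
  have balance: "\<pi> z = orbit_ratio \<sigma>2 \<kappa>2 (\<phi> z) * \<pi> (\<sigma>1 z)" if "z \<in> Z1" for z
  proof -
    have "\<pi> (\<sigma>1 z) > 0"
      using \<pi>_simplex \<sigma>1(1) that by (auto simp: open_simplex_def)
    moreover have "\<pi> z / \<pi> (\<sigma>1 z) = orbit_ratio \<sigma>2 \<kappa>2 (\<phi> z)"
      using \<pi> that orbit_ratio_morphism[OF assms(3) \<sigma>1(1) that]
      by (simp add: neutral_distributions_def)
    ultimately show ?thesis
      by (simp add: field_simps)
  qed
  have "?\<rho> z' / ?\<rho> (\<sigma>2 z') = orbit_ratio \<sigma>2 \<kappa>2 z'" if z': "z' \<in> Z2" for z'
  proof -
    have "?\<rho> z' = orbit_ratio \<sigma>2 \<kappa>2 z' * pushforward Z1 \<phi> (\<lambda>z. \<pi> (\<sigma>1 z)) z'"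
      unfolding pushforward_def sum_distrib_left
      by (rule sum.cong) (use balance in auto)
    also have "\<dots> = orbit_ratio \<sigma>2 \<kappa>2 z' * ?\<rho> (\<sigma>2 z')"
      using pushforward_comp_involution[of \<sigma>1 Z1 \<phi> \<sigma>2 z' \<pi>] \<sigma>1 equivariant \<sigma>2(2)[OF z'] by simp
    finally have "?\<rho> z' = orbit_ratio \<sigma>2 \<kappa>2 z' * ?\<rho> (\<sigma>2 z')" .
    moreover have "?\<rho> (\<sigma>2 z') > 0"
      using simplex \<sigma>2(1) z' by (auto simp: open_simplex_def)
    ultimately show ?thesis
      by simp
  qed
  with simplex show "?\<rho> \<in> neutral_distributions Z2 \<sigma>2 \<kappa>2"
    by (simp add: neutral_distributions_def)
qed

end
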